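(* Let $G$ be a locally compact Abelian group and let $S\subset G$ be a Borel measurable set with positive asymptotic uniform upper density, $\overline{D}(S)>0$. Then the difference set $S-S=\{s-t: s,t\in S\}$ is a syndetic set in $G$.
   Context: $G$ is a locally compact (Hausdorff) Abelian group written additively, with a fixed Haar measure $\mu$. $\mathcal{B}_0$ denotes the family of all nonempty open subsets of $G$ with compact closure. For a Borel set $A\subset G$, the asymptotic uniform upper density is $$\overline{D}(A):=\inf_{C}\ \sup_{V\in\mathcal{B}_0}\frac{\mu(A\cap V)}{\mu(C+V)},$$ where the infimum is over all nonempty compact $C\subset G$ and $C+V=\{c+v:c\in C,v\in V\}$. A set $T\subset G$ is syndetic if there is a compact set $K\subset G$ such that for every $g\in G$ there is $k\in K$ with $g+k\in T$, i.e. $\bigcup_{k\in K}(T-k)=G$. *)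

theory Defs
  imports "HOL-Analysis.Analysis"
begin

(* A Haar measure: a nonzero, translation-invariant Radon measure on the Borel sets.
   Outer regularity is required for all Borel sets, inner regularity only for open sets:
   on a group that is not sigma-compact, inner regularity for all Borel sets can fail. *)
definition haar_measure :: "'a::topological_ab_group_add measure \<Rightarrow> bool" where
  "haar_measure M \<longleftrightarrow>
     sets M = sets borel \<and>
     emeasure M UNIV \<noteq> 0 \<and>
     (\<forall>K. compact K \<longrightarrow> emeasure M K < \<infinity>) \<and>
     (\<forall>A\<in>sets borel. emeasure M A = (INF U\<in>{U. open U \<and> A \<subseteq> U}. emeasure M U)) \<and>
     (\<forall>U. open U \<longrightarrow> emeasure M U = (SUP K\<in>{K. compact K \<and> K \<subseteq> U}. emeasure M K)) \<and>
     (\<forall>g. \<forall>A\<in>sets borel. emeasure M ((\<lambda>x. g + x) ` A) = emeasure M A)"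

definition open_rel_compact :: "'a::topological_space set set" where
  "open_rel_compact = {V. open V \<and> V \<noteq> {} \<and> compact (closure V)}"

(* For a Haar measure on a locally compact Hausdorff group, C + V is nonempty, open and
   relatively compact, so the denominator below is positive and finite: no quotient
   involves 0 or infinity in the denominator. *)
definition upper_density :: "'a::topological_ab_group_add measure \<Rightarrow> 'a set \<Rightarrow> ennreal" where
  "upper_density M A =
     (INF C\<in>{C. compact C \<and> C \<noteq> {}}. SUP V\<in>open_rel_compact.
        emeasure M (A \<inter> V) / emeasure M {c + v | c v. c \<in> C \<and> v \<in> V})"

definition syndetic :: "'a::topological_ab_group_add set \<Rightarrow> bool" where
  "syndetic T \<longleftrightarrow> (\<exists>K. compact K \<and> (\<forall>g. \<exists>k\<in>K. g + k \<in> T))"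

end

theory Submission
  imports Defs
begin

text \<open>
  If \<open>S - S\<close> is not syndetic, no finite set witnesses syndeticity, so one can greedily choose
  arbitrarily many pairwise disjoint translates of \<open>S\<close>. For a set \<open>C\<close> of \<open>n\<close> such translation
  parameters, invariance gives \<open>n * \<mu> (S \<inter> V) \<le> \<mu> (C + V)\<close> for every \<open>V\<close>, hence the upper density
  of \<open>S\<close> is at most \<open>1 / n\<close>.
\<close>

lemma ennreal_divide_le_inverse_of_nat:
  fixes a b :: ennreal
  assumes "of_nat n * a \<le> b" "n > 0"
  shows "a / b \<le> inverse (of_nat n)"
proof -
  have n0: "of_nat n \<noteq> (0::ennreal)" and nt: "of_nat n \<noteq> (top::ennreal)"
    using assms by auto
  have "a = (of_nat n * a) * inverse (of_nat n)"
    using n0 nt by (metis divide_ennreal_def ennreal_mult_divide_eq mult.commute)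
  also have "\<dots> \<le> inverse (of_nat n) * b"
    using assms(1) by (subst mult.commute) (rule mult_left_mono, auto)
  finally have "a \<le> inverse (of_nat n) * b" .
  \<comment> \<open>Cancelling \<open>b\<close> requires \<open>0 < b < top\<close>. At the extremes
    the quotient is 0: \<open>b = 0\<close> forces \<open>a = 0\<close>, and
    \<open>0 / 0 = 0\<close> in \<open>ennreal\<close>; for \<open>b = top\<close>,
    \<open>inverse top = 0\<close>.\<close>
  then show ?thesis
  proof (cases "b = 0 \<or> b = top")
    case True
    then show ?thesis using \<open>a \<le> inverse (of_nat n) * b\<close> by auto
  next
    case False
    have "a / b \<le> (inverse (of_nat n) * b) / b"
      by (rule divide_right_mono_ennreal) fact
    then show ?thesis using False by (simp add: ennreal_mult_divide_eq)
  qed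
qed

lemma translation_in_borel:
  fixes A :: "'a::topological_ab_group_add set"
  assumes "A \<in> sets borel"
  shows "(\<lambda>x. g + x) ` A \<in> sets borel"
proof -
  have "(\<lambda>x. g + x) ` A = (\<lambda>x. - g + x) -` A \<inter> space borel"
    by (auto simp: image_iff algebra_simps) (metis diff_add_cancel)
  moreover have "(\<lambda>x. - g + x) \<in> borel_measurable borel"
    by (intro borel_measurable_continuous_onI continuous_intros)
  ultimately show ?thesis
    using assms by (metis measurable_sets)
qed

lemma not_syndetic_disjoint_translates:
  fixes S :: "'a::topological_ab_group_add set"
  assumes "\<not> syndetic {s - t | s t. s \<in> S \<and> t \<in> S}" and "S \<noteq> {}"
  shows "\<exists>F. finite F \<and> card F = n \<and> disjoint_family_on (\<lambda>b. (\<lambda>x. b + x) ` S) F"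
proof (induction n)
  case 0
  show ?case by (rule exI[of _ "{}"]) (simp add: disjoint_family_on_def)
next
  case (Suc n)
  then obtain F where F: "finite F" "card F = n" "disjoint_family_on (\<lambda>b. (\<lambda>x. b + x) ` S) F"
    by blast
  \<comment> \<open>The candidate is \<open>-F\<close> because \<open>g + S\<close> meets
    \<open>b + S\<close> exactly when \<open>g - b\<close> lies in \<open>S - S\<close>. Its failure
    as a syndeticity witness yields one \<open>g\<close> whose translate avoids all earlier
    ones.\<close>
  have "compact (uminus ` F)"
    using F by (simp add: finite_imp_compact)
  with assms(1) have "\<exists>g. \<forall>k\<in>uminus ` F. g + k \<notin> {s - t | s t. s \<in> S \<and> t \<in> S}"
    unfolding syndetic_def not_ex de_Morgan_conj not_all by meson
  then obtain g where g: "\<forall>k\<in>uminus ` F. g + k \<notin> {s - t | s t. s \<in> S \<and> t \<in> S}" ..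
  have disj: "(\<lambda>x. g + x) ` S \<inter> (\<lambda>x. b + x) ` S = {}" if "b \<in> F" for b
  proof (rule ccontr)
    assume "\<not> ?thesis"
    then obtain s t where st: "s \<in> S" "t \<in> S" "g + t = b + s" by blast
    then have "g + - b = s - t" by (simp add: algebra_simps)
    with g st(1,2) that show False by blast
  qed
  \<comment> \<open>If \<open>g\<close> were in \<open>F\<close>, then \<open>g + S\<close> would be
    disjoint from itself, hence empty. So the cardinality really grows.\<close>
  have "g \<notin> F" using disj \<open>S \<noteq> {}\<close> by fastforce
  with F disj have "finite (insert g F) \<and> card (insert g F) = Suc n \<and>
      disjoint_family_on (\<lambda>b. (\<lambda>x. b + x) ` S) (insert g F)"
    by (auto simp: disjoint_family_on_insert)
  then show ?case by blast
qed

text \<open>A finite set is compact, so \<open>F\<close> itself is an admissible \<open>C\<close> in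
  the infimum. The bound then holds for each \<open>V\<close> separately, since \<open>F + V\<close>
  contains \<open>card F\<close> disjoint copies of \<open>S \<inter> V\<close>.\<close>

lemma upper_density_le_of_disjoint_translates:
  fixes \<mu> :: "'a::topological_ab_group_add measure"
  assumes \<mu>: "haar_measure \<mu>" and S: "S \<in> sets borel"
    and F: "finite F" "F \<noteq> {}" "disjoint_family_on (\<lambda>b. (\<lambda>x. b + x) ` S) F"
  shows "upper_density \<mu> S \<le> inverse (of_nat (card F))"
  unfolding upper_density_def
proof (rule INF_lower2[of F], use F in \<open>simp add: finite_imp_compact\<close>, rule SUP_least)
  fix V :: "'a set" assume "V \<in> open_rel_compact"
  then have V: "V \<in> sets borel" by (simp add: open_rel_compact_def)
  have sets: "sets \<mu> = sets borel"
    and inv: "\<And>g A. A \<in> sets borel \<Longrightarrow> emeasure \<mu> ((\<lambda>x. g + x) ` A) = emeasure \<mu> A"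
    using \<mu> by (simp_all add: haar_measure_def)
  have SV: "S \<inter> V \<in> sets borel" using S V by blast
  \<comment> \<open>Written as a finite union of translates of \<open>V\<close>, the set
    \<open>F + V\<close> is visibly Borel, as monotonicity of \<open>emeasure\<close>
    requires.\<close>
  have sum_eq: "{c + v | c v. c \<in> F \<and> v \<in> V} = (\<Union>b\<in>F. (\<lambda>x. b + x) ` V)" by blast
  have "of_nat (card F) * emeasure \<mu> (S \<inter> V) = (\<Sum>b\<in>F. emeasure \<mu> ((\<lambda>x. b + x) ` (S \<inter> V)))"
    using inv[OF SV] by simp
  also have "\<dots> = emeasure \<mu> (\<Union>b\<in>F. (\<lambda>x. b + x) ` (S \<inter> V))"
  proof (rule sum_emeasure)
    show "(\<lambda>b. (\<lambda>x. b + x) ` (S \<inter> V)) ` F \<subseteq> sets \<mu>"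
      using translation_in_borel[OF SV] sets by blast
    show "disjoint_family_on (\<lambda>b. (\<lambda>x. b + x) ` (S \<inter> V)) F"
      using F(3) by (rule disjoint_family_on_bisimulation) blast
  qed fact
  also have "\<dots> \<le> emeasure \<mu> {c + v | c v. c \<in> F \<and> v \<in> V}"
    unfolding sum_eq using translation_in_borel[OF V] F(1) sets
    by (intro emeasure_mono sets.finite_UN) auto
  finally show "emeasure \<mu> (S \<inter> V) / emeasure \<mu> {c + v | c v. c \<in> F \<and> v \<in> V}
      \<le> inverse (of_nat (card F))"
    by (rule ennreal_divide_le_inverse_of_nat) (use F in \<open>simp add: card_gt_0_iff\<close>)
qed

theorem theorem1:
  fixes \<mu> :: "'a::{topological_ab_group_add, t2_space} measure"
    and S :: "'a set"
  assumes "locally_compact_space (euclidean :: 'a topology)"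
    and "haar_measure \<mu>"
    and "S \<in> sets borel"
    and "upper_density \<mu> S > 0"
  shows "syndetic {s - t | s t. s \<in> S \<and> t \<in> S}"
proof (rule ccontr)
  assume not_syndetic: "\<not> ?thesis"
  have "S \<noteq> {}"
  proof
    assume "S = {}"
    \<comment> \<open>Any nonempty compact set would do in place of \<open>{0}\<close>: all
      numerators vanish.\<close>
    then have "upper_density \<mu> S \<le> 0"
      unfolding upper_density_def by (intro INF_lower2[of "{0}"] SUP_least) auto
    with assms(4) show False by simp
  qed
  have bound: "upper_density \<mu> S \<le> inverse (of_nat (Suc n))" for n
  proof -
    \<comment> \<open>The size \<open>Suc n\<close> keeps \<open>F\<close> nonempty, hence
      admissible in the infimum.\<close>
    obtain F where F: "finite F" "card F = Suc n" "disjoint_family_on (\<lambda>b. (\<lambda>x. b + x) ` S) F"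
      using not_syndetic_disjoint_translates[OF not_syndetic \<open>S \<noteq> {}\<close>] by blast
    then show ?thesis
      using upper_density_le_of_disjoint_translates[OF assms(2,3), of F] by (metis card.empty nat.distinct(1))
  qed
  have "(\<lambda>n. ennreal (inverse (real (Suc n)))) \<longlonglongrightarrow> ennreal 0"
    by (intro tendsto_ennrealI LIMSEQ_inverse_real_of_nat)
  moreover have "upper_density \<mu> S \<le> ennreal (inverse (real (Suc n)))" for n
    using bound[of n] by (metis ennreal_of_nat_eq_real_of_nat inverse_ennreal of_nat_0_less_iff zero_less_Suc)
  ultimately have "upper_density \<mu> S \<le> ennreal 0"
    using LIMSEQ_le_const by blast
  with assms(4) show False by simp
qed

end
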